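(* Let $\Phi=(\phi_n)_{n\in I}$ and $\Psi=(\psi_n)_{n\in I}$ be frames for a separable Hilbert space $\mathcal{H}$, and let $m=(m_n)_{n\in I}$ be a sequence of complex numbers such that $m_n\neq 0$ for every $n$ and the sequence $m\Psi=(m_n\psi_n)_{n\in I}$ is a frame for $\mathcal{H}$. Consider the following statements: (1) $M_{m,\Phi,\Psi}$ is invertible and $\Phi^\dagger=\widetilde{\Phi}$, where $\Phi^\dagger:=\left((M_{m,\Phi,\Psi}^{-1})^*(\overline{m_n}\psi_n)\right)_{n\in I}$; (2) $\Phi$ is equivalent to $\overline{m}\Psi=(\overline{m_n}\psi_n)_{n\in I}$; (3) $M_{m,\Phi,\Psi}$ is invertible and $M_{m,\Phi,\Psi}^{-1}=M_{1/m,\widetilde{\Psi},\widetilde{\Phi}}$. Then (1) $\Leftrightarrow$ (2) and (2) $\Rightarrow$ (3).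
   Context: $I$ is a countable index set. A sequence $(\phi_n)_{n\in I}$ in $\mathcal{H}$ is a frame for $\mathcal{H}$ if there are $A,B\in(0,\infty)$ with $A\|f\|^2\le\sum_{n\in I}|\langle f,\phi_n\rangle|^2\le B\|f\|^2$ for all $f\in\mathcal{H}$. Its frame operator is $S_\Phi f=\sum_{n\in I}\langle f,\phi_n\rangle\phi_n$ (bounded and bijective on $\mathcal{H}$), and its canonical dual frame is $\widetilde{\Phi}=(S_\Phi^{-1}\phi_n)_{n\in I}$; likewise $\widetilde{\Psi}=(S_\Psi^{-1}\psi_n)_{n\in I}$. Two frames $(\phi_n)_{n\in I}$ and $(\psi_n)_{n\in I}$ for $\mathcal{H}$ are called equivalent if there is a bounded bijective operator $G:\mathcal{H}\to\mathcal{H}$ with $\psi_n=G\phi_n$ for all $n$. For a complex sequence $m=(m_n)_{n\in I}$ and sequences $\Phi,\Psi$ in $\mathcal{H}$, the multiplier $M_{m,\Phi,\Psi}$ is the operator $M_{m,\Phi,\Psi}f=\sum_{n\in I} m_n\langle f,\psi_n\rangle\phi_n$, defined on those $f\in\mathcal{H}$ for which the series converges. $1/m$ denotes the sequence $(1/m_n)_{n\in I}$. An operator on $\mathcal{H}$ is called invertible if it is a bounded bijective operator from $\mathcal{H}$ onto $\mathcal{H}$. *)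

theory Defs
  imports "HOL-Analysis.Analysis"
begin

text \<open>
  A complex inner product space, presented over the library's class of real inner product spaces:
  the norm is the one induced by the complex inner product because
  \<open>cinner x x\<close> is real and \<open>inner x x = Re (cinner x x)\<close>.
  The complex inner product is linear in its first argument.
\<close>

class complex_inner = real_inner +
  fixes scaleC :: "complex \<Rightarrow> 'a \<Rightarrow> 'a"  (infixr \<open>*\<^sub>C\<close> 75)
    and cinner :: "'a \<Rightarrow> 'a \<Rightarrow> complex"
  assumes scaleC_add_right: "a *\<^sub>C (x + y) = a *\<^sub>C x + a *\<^sub>C y"
    and scaleC_add_left: "(a + b) *\<^sub>C x = a *\<^sub>C x + b *\<^sub>C x"
    and scaleC_scaleC: "a *\<^sub>C (b *\<^sub>C x) = (a * b) *\<^sub>C x"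
    and scaleC_of_real: "complex_of_real r *\<^sub>C x = scaleR r x"
    and cinner_commute: "cinner x y = cnj (cinner y x)"
    and cinner_add_left: "cinner (x + y) z = cinner x z + cinner y z"
    and cinner_scaleC_left: "cinner (a *\<^sub>C x) y = a * cinner x y"
    and inner_eq_Re_cinner: "inner x y = Re (cinner x y)"

class complex_hilbert = complex_inner + complete_space

instantiation complex :: complex_hilbert
begin

definition scaleC_complex_def: "(a::complex) *\<^sub>C x = a * x"
definition cinner_complex_def: "cinner (x::complex) y = x * cnj y"

instance
  by standard
    (auto simp: scaleC_complex_def cinner_complex_def algebra_simps scaleR_conv_of_real
      inner_complex_def)

end

lemma cinner_self: "cinner x x = complex_of_real ((norm (x::'a::complex_inner))\<^sup>2)"
proof -
  have "cinner x x \<in> \<real>"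
    using cinner_commute[of x x] by (simp add: Reals_cnj_iff)
  then show ?thesis
    by (metis Re_complex_of_real Reals_cases inner_eq_Re_cinner power2_norm_eq_inner)
qed


text \<open>Bounded operators are everywhere defined and complex linear.\<close>

definition bounded_clinear :: "('a::complex_inner \<Rightarrow> 'a) \<Rightarrow> bool" where
  "bounded_clinear T \<longleftrightarrow> bounded_linear T \<and> (\<forall>c x. T (c *\<^sub>C x) = c *\<^sub>C T x)"

definition bounded_bijective :: "('a::complex_inner \<Rightarrow> 'a) \<Rightarrow> bool" where
  "bounded_bijective T \<longleftrightarrow> bounded_clinear T \<and> bij T"

definition cadjoint :: "('a::complex_inner \<Rightarrow> 'a) \<Rightarrow> 'a \<Rightarrow> 'a" where
  "cadjoint T = (THE T'. \<forall>x y. cinner (T x) y = cinner x (T' y))"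


text \<open>
  Sequences are functions \<open>\<phi> :: 'i \<Rightarrow> 'a\<close> of which only the values on the index set \<open>I\<close> matter.
  As \<open>I\<close> carries no order, series over \<open>I\<close> are the library's unordered sums, i.e. limits along
  the net of finite subsets of \<open>I\<close>. An unordered sum that does not converge has the
  default value \<open>0\<close>, so convergence is stated separately wherever it is part of a definition.
\<close>

definition is_frame :: "'i set \<Rightarrow> ('i \<Rightarrow> 'a::complex_hilbert) \<Rightarrow> bool" where
  "is_frame I \<phi> \<longleftrightarrow>
     (\<exists>A>0. \<exists>B>0. \<forall>f.
        (\<lambda>n. (cmod (cinner f (\<phi> n)))\<^sup>2) summable_on I \<and>
        A * (norm f)\<^sup>2 \<le> (\<Sum>\<^sub>\<infinity>n\<in>I. (cmod (cinner f (\<phi> n)))\<^sup>2) \<and>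
        (\<Sum>\<^sub>\<infinity>n\<in>I. (cmod (cinner f (\<phi> n)))\<^sup>2) \<le> B * (norm f)\<^sup>2)"

definition frame_operator :: "'i set \<Rightarrow> ('i \<Rightarrow> 'a::complex_hilbert) \<Rightarrow> 'a \<Rightarrow> 'a" where
  "frame_operator I \<phi> f = (\<Sum>\<^sub>\<infinity>n\<in>I. cinner f (\<phi> n) *\<^sub>C \<phi> n)"

definition canonical_dual :: "'i set \<Rightarrow> ('i \<Rightarrow> 'a::complex_hilbert) \<Rightarrow> 'i \<Rightarrow> 'a" where
  "canonical_dual I \<phi> n = inv (frame_operator I \<phi>) (\<phi> n)"

definition equivalent_frames ::
    "'i set \<Rightarrow> ('i \<Rightarrow> 'a::complex_hilbert) \<Rightarrow> ('i \<Rightarrow> 'a) \<Rightarrow> bool" where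
  "equivalent_frames I \<phi> \<psi> \<longleftrightarrow>
     is_frame I \<phi> \<and> is_frame I \<psi> \<and> (\<exists>G. bounded_bijective G \<and> (\<forall>n\<in>I. \<psi> n = G (\<phi> n)))"


text \<open>
  A multiplier is in general only partially defined; it is represented by its domain together
  with a total function that is meaningful on that domain.
\<close>

definition multiplier_dom ::
    "'i set \<Rightarrow> ('i \<Rightarrow> complex) \<Rightarrow> ('i \<Rightarrow> 'a::complex_hilbert) \<Rightarrow> ('i \<Rightarrow> 'a) \<Rightarrow> 'a set" where
  "multiplier_dom I m \<phi> \<psi> = {f. (\<lambda>n. (m n * cinner f (\<psi> n)) *\<^sub>C \<phi> n) summable_on I}"

definition multiplier ::
    "'i set \<Rightarrow> ('i \<Rightarrow> complex) \<Rightarrow> ('i \<Rightarrow> 'a::complex_hilbert) \<Rightarrow> ('i \<Rightarrow> 'a) \<Rightarrow> 'a \<Rightarrow> 'a" where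
  "multiplier I m \<phi> \<psi> f = (\<Sum>\<^sub>\<infinity>n\<in>I. (m n * cinner f (\<psi> n)) *\<^sub>C \<phi> n)"

definition multiplier_invertible ::
    "'i set \<Rightarrow> ('i \<Rightarrow> complex) \<Rightarrow> ('i \<Rightarrow> 'a::complex_hilbert) \<Rightarrow> ('i \<Rightarrow> 'a) \<Rightarrow> bool" where
  "multiplier_invertible I m \<phi> \<psi> \<longleftrightarrow>
     multiplier_dom I m \<phi> \<psi> = UNIV \<and> bounded_bijective (multiplier I m \<phi> \<psi>)"

end

theory Submission
  imports Defs
begin

text \<open>
  Put \<open>\<theta>\<^sub>n = cnj m\<^sub>n \<psi>\<^sub>n\<close>. The multiplier is the cross operator \<open>M f = \<Sum> \<langle>f, \<theta>\<^sub>n\<rangle> \<phi>\<^sub>n\<close>, whose adjoint is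
  the cross operator \<open>M' f = \<Sum> \<langle>f, \<phi>\<^sub>n\<rangle> \<theta>\<^sub>n\<close> with the two frames exchanged.
  If \<open>\<theta>\<^sub>n = G \<phi>\<^sub>n\<close> with \<open>G\<close> bounded and bijective, then applying \<open>G\<close> termwise gives \<open>G M = S\<^sub>\<theta>\<close> and
  \<open>M' = G S\<^sub>\<phi>\<close>, so \<open>M\<close> is bijective and \<open>(M')\<inverse> \<theta>\<^sub>n = S\<^sub>\<phi>\<inverse> \<phi>\<^sub>n\<close>. Conversely, that identity says
  \<open>\<theta>\<^sub>n = G \<phi>\<^sub>n\<close> for \<open>G = M' S\<^sub>\<phi>\<inverse>\<close>. It also gives
  \<open>\<langle>f, S\<^sub>\<phi>\<inverse> \<phi>\<^sub>n\<rangle> = \<langle>M\<inverse> f, \<theta>\<^sub>n\<rangle> = m\<^sub>n \<langle>M\<inverse> f, \<psi>\<^sub>n\<rangle>\<close>, so the multiplier in (3) sends \<open>f\<close> to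
  \<open>S\<^sub>\<psi>\<inverse> S\<^sub>\<psi> (M\<inverse> f) = M\<inverse> f\<close>.
\<close>

section \<open>Bounded operators on real Hilbert spaces\<close>

lemma coercive_bounded_below:
  fixes A :: "'a::real_inner \<Rightarrow> 'a"
  assumes "\<And>x. a * (norm x)\<^sup>2 \<le> inner (A x) x"
  shows "a * norm x \<le> norm (A x)"
proof (cases "x = 0")
  case False
  have "a * norm x * norm x \<le> norm (A x) * norm x"
    using assms[of x] norm_cauchy_schwarz[of "A x" x] by (simp add: power2_eq_square mult.assoc)
  with False show ?thesis by simp
qed simp

text \<open>The lower bound, read at \<open>inv A y\<close>, bounds the inverse by 1/a; linearity
  transfers through injectivity.\<close>

lemma bounded_linear_inv:
  fixes A :: "'a::real_normed_vector \<Rightarrow> 'b::real_normed_vector"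
  assumes A: "bounded_linear A" and bij: "bij A"
    and a: "a > 0" "\<And>x. a * norm x \<le> norm (A x)"
  shows "bounded_linear (inv A)"
proof -
  interpret A: bounded_linear A by fact
  have AiA [simp]: "A (inv A y) = y" for y
    using bij by (simp add: bij_is_surj surj_f_inv_f)
  have eqI: "x = y" if "A x = A y" for x y
    using that bij by (simp add: bij_is_inj inj_eq)
  show ?thesis
  proof (rule bounded_linear_intro[where K = "1 / a"])
    show "norm (inv A y) \<le> norm y * (1 / a)" for y
      using a(2)[of "inv A y"] a(1) by (simp add: field_simps)
  qed (auto intro!: eqI simp: A.add A.scaleR)
qed

text \<open>Solutions of A x = y are the fixed points of x + c (y - A x). For suitable c > 0
  coercivity makes x - c A x a strict contraction, so Banach's fixed point theorem gives
  surjectivity; the lower bound gives injectivity.\<close>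

lemma lax_milgram:
  fixes A :: "'a::{real_inner, complete_space} \<Rightarrow> 'a"
  assumes A: "bounded_linear A" and a: "a > 0"
    and coercive: "\<And>x. a * (norm x)\<^sup>2 \<le> inner (A x) x"
  shows "bij A"
proof -
  interpret A: bounded_linear A by fact
  obtain K0 where K0: "K0 > 0" "\<And>x. norm (A x) \<le> norm x * K0"
    using A.pos_bounded by blast
  \<comment> \<open>Taking K at least a ensures a c \<le> 1, so the square root in \<open>q\<close>
    has a nonnegative argument.\<close>
  define K where "K = max K0 a"
  have K: "K > 0" "norm (A x) \<le> norm x * K" "a \<le> K" for x
    using K0(1) order_trans[OF K0(2) mult_left_mono[of K0 K "norm x"]] by (auto simp: K_def)
  \<comment> \<open>This c minimises 1 - 2 a c + c^2 K^2, the bound for the squared contraction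
    factor; the minimum is 1 - a c.\<close>
  define c where "c = a / K\<^sup>2"
  define q where "q = sqrt (1 - a * c)"
  have c: "c > 0" "a * c \<le> 1" "a * c > 0"
    using a K(1,3) mult_mono[of a K a K] by (auto simp: c_def power2_eq_square divide_le_eq)
  have q: "0 \<le> q" "q < 1" "q\<^sup>2 = 1 - a * c"
    using c by (auto simp: q_def)
  have contraction: "norm (x - c *\<^sub>R A x) \<le> q * norm x" for x
  proof (rule power2_le_imp_le)
    have "c\<^sup>2 * (norm (A x))\<^sup>2 \<le> c\<^sup>2 * (norm x * K)\<^sup>2"
      by (intro mult_left_mono power_mono K) auto
    also have "\<dots> = a * c * (norm x)\<^sup>2"
      using K(1) by (simp add: c_def field_simps power2_eq_square)
    finally have 1: "c\<^sup>2 * (norm (A x))\<^sup>2 \<le> a * c * (norm x)\<^sup>2" .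
    have 2: "c * (a * (norm x)\<^sup>2) \<le> c * inner (A x) x"
      by (intro mult_left_mono coercive) (use c in auto)
    have "(norm (x - c *\<^sub>R A x))\<^sup>2 = (norm x)\<^sup>2 - 2 * (c * inner (A x) x) + c\<^sup>2 * (norm (A x))\<^sup>2"
      unfolding power2_norm_eq_inner
      by (simp add: algebra_simps inner_commute power2_eq_square)
    also have "\<dots> \<le> (1 - a * c) * (norm x)\<^sup>2"
      using 1 2 by (simp add: algebra_simps)
    finally show "(norm (x - c *\<^sub>R A x))\<^sup>2 \<le> (q * norm x)\<^sup>2"
      by (simp add: power_mult_distrib q)
  qed (use q in auto)
  show ?thesis
  proof (rule bijI)
    show "inj A"
    proof (rule injI)
      fix x y assume "A x = A y"
      then have "a * norm (x - y) \<le> 0"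
        using coercive_bounded_below[of a A "x - y", OF coercive] by (simp add: A.diff)
      then show "x = y"
        using a by (simp add: mult_le_0_iff)
    qed
    show "surj A"
    proof (rule surjI)
      fix y
      have "\<exists>!x. x + c *\<^sub>R (y - A x) = x"
      proof (rule banach_fix_type[OF q(1,2)], intro allI)
        fix u v
        have eq: "u + c *\<^sub>R (y - A u) - (v + c *\<^sub>R (y - A v)) = (u - v) - c *\<^sub>R A (u - v)"
          by (simp add: A.diff algebra_simps)
        show "dist (u + c *\<^sub>R (y - A u)) (v + c *\<^sub>R (y - A v)) \<le> q * dist u v"
          using contraction[of "u - v"] unfolding dist_norm eq .
      qed
      then show "A (SOME x. A x = y) = y"
        using c(1) by (intro someI_ex[of "\<lambda>x. A x = y"]) auto
    qed
  qed
qed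

lemma surj_adjoint_bounded_below:
  fixes T T' :: "'a::{real_inner, complete_space} \<Rightarrow> 'a"
  assumes T': "bounded_linear T'" and adj: "\<And>x y. inner (T x) y = inner x (T' y)"
    and surj: "surj T"
  obtains c where "c > 0" "\<And>y. c * norm y \<le> norm (T' y)"
proof -
  interpret T': bounded_linear T' by fact
  txt \<open>For \<open>x = T z\<close> the vectors \<open>y\<close> with \<open>norm (T' y) \<le> 1\<close> satisfy \<open>\<bar>inner x y\<bar> \<le> norm z\<close>;
    by Baire's theorem such pointwise boundedness is uniform.\<close>
  define E where "E k = {x. \<forall>y. norm (T' y) \<le> 1 \<longrightarrow> \<bar>inner x y\<bar> \<le> real k}" for k
  have closed: "closed (E k)" for k
  proof -
    have "E k = (\<Inter>y\<in>{y. norm (T' y) \<le> 1}. {x. \<bar>inner x y\<bar> \<le> real k})"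
      by (auto simp: E_def)
    then show ?thesis
      by (auto intro!: closed_INT closed_Collect_le continuous_intros)
  qed
  have "x \<in> (\<Union>k. E k)" for x
  proof -
    obtain z where z: "x = T z"
      using surj by (meson surjD)
    obtain k where k: "norm z \<le> real k"
      using real_arch_simple by blast
    have "\<bar>inner x y\<bar> \<le> real k" if "norm (T' y) \<le> 1" for y
    proof -
      have "\<bar>inner x y\<bar> \<le> norm z * norm (T' y)"
        unfolding z adj by (rule Cauchy_Schwarz_ineq2)
      also have "\<dots> \<le> norm z * 1"
        by (intro mult_left_mono that) auto
      finally show ?thesis using k by simp
    qed
    then show ?thesis by (auto simp: E_def)
  qed
  then have cover: "(\<Union>k. E k) = UNIV" by blast
  have "\<exists>k. euclidean interior_of (E k) \<noteq> {}"
  proof (rule ccontr)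
    assume "\<not> ?thesis"
    then have "euclidean interior_of (\<Union>(range E)) = {}"
      by (intro Baire_category_alt) (use closed completely_metrizable_space_euclidean in auto)
    then show False using cover by simp
  qed
  then obtain k x0 where "x0 \<in> interior (E k)"
    by auto
  then obtain r where r: "r > 0" "cball x0 r \<subseteq> E k"
    by (auto simp: mem_interior_cball)
  \<comment> \<open>Both the centre x0 and x0 + z, with z of length r in the direction of y, lie in
    \<open>E k\<close>. Subtracting the two estimates gives r * norm y \<le> 2 k.\<close>
  have bound: "norm y \<le> 2 * real k / r" if y: "norm (T' y) \<le> 1" for y
  proof (cases "y = 0")
    case False
    define z where "z = (r / norm y) *\<^sub>R y"
    have "norm z = r"
      using False r(1) by (simp add: z_def)
    then have "x0 \<in> E k" "x0 + z \<in> E k"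
      using r by (auto simp: dist_norm intro!: subsetD[OF r(2)])
    then have "\<bar>inner x0 y\<bar> \<le> real k" "\<bar>inner x0 y + inner z y\<bar> \<le> real k"
      using y by (auto simp: E_def inner_add_left)
    moreover have "inner z y = r * norm y"
      using False by (simp add: z_def flip: power2_norm_eq_inner) (simp add: power2_eq_square)
    ultimately have "r * norm y \<le> 2 * real k"
      by linarith
    then show ?thesis
      using r(1) by (simp add: field_simps)
  qed (use r in simp)
  \<comment> \<open>The summand 1 keeps C positive when k = 0 and makes the bound strict. Below, y
    is rescaled to norm C, since T' y is not yet known to be nonzero and cannot be normalised
    instead.\<close>
  define C where "C = 2 * real k / r + 1"
  have C: "C > 0" using r(1) by (simp add: C_def add_nonneg_pos)
  have small: "norm y < C" if "norm (T' y) \<le> 1" for y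
    using bound[OF that] by (simp add: C_def)
  have "1 / C * norm y \<le> norm (T' y)" for y
  proof (rule ccontr)
    assume less: "\<not> ?thesis"
    then have y: "norm y > 0" by auto
    have "norm (T' ((C / norm y) *\<^sub>R y)) \<le> 1"
      using less y C by (simp add: T'.scaleR field_simps)
    from small[OF this] show False
      using y C by simp
  qed
  then show thesis using that[of "1 / C"] C by simp
qed

text \<open>The form of T T' at x is the squared norm of T' x, which is coercive because T is onto.
  Hence T T' is bijective, and T' is \<open>inv T\<close> after T T'.\<close>

lemma bij_adjoint:
  fixes T T' :: "'a::{real_inner, complete_space} \<Rightarrow> 'a"
  assumes T: "bounded_linear T" and T': "bounded_linear T'"
    and adj: "\<And>x y. inner (T x) y = inner x (T' y)" and bij: "bij T"
  shows "bij T'"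
proof -
  obtain c where c: "c > 0" "\<And>y. c * norm y \<le> norm (T' y)"
    using surj_adjoint_bounded_below[OF T' adj bij_is_surj[OF bij]] by blast
  have "bij (\<lambda>x. T (T' x))"
  proof (rule lax_milgram)
    show "bounded_linear (\<lambda>x. T (T' x))"
      by (rule bounded_linear_compose[OF T T'])
    show "c\<^sup>2 * (norm x)\<^sup>2 \<le> inner (T (T' x)) x" for x
      using power_mono[OF c(2)[of x], of 2] c(1)
      by (simp add: adj power_mult_distrib power2_norm_eq_inner)
  qed (use c in auto)
  then have "bij (T \<circ> T')"
    by (simp add: comp_def)
  then have "bij (inv T \<circ> (T \<circ> T'))"
    by (rule bij_comp[OF _ bij_imp_bij_inv[OF bij]])
  moreover have "inv T \<circ> (T \<circ> T') = T'"
    using bij by (simp add: fun_eq_iff bij_is_inj)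
  ultimately show ?thesis by metis
qed

section \<open>Complex inner products and adjoints\<close>

lemma cinner_eqI:
  fixes x y :: "'a::complex_inner"
  assumes "\<And>z. cinner z x = cinner z y"
  shows "x = y"
proof -
  have "inner (x - y) x = inner (x - y) y"
    by (simp add: inner_eq_Re_cinner assms)
  then have "inner (x - y) (x - y) = 0"
    by (simp add: inner_diff_right)
  then show ?thesis by simp
qed

lemma cinner_scaleC_right: "cinner x (a *\<^sub>C y) = cnj a * cinner x y"
  by (metis cinner_commute cinner_scaleC_left complex_cnj_mult)

lemma norm_scaleC [simp]: "norm (a *\<^sub>C x) = cmod a * norm (x::'a::complex_inner)"
proof -
  have "complex_of_real ((norm (a *\<^sub>C x))\<^sup>2) = cinner (a *\<^sub>C x) (a *\<^sub>C x)"
    by (rule cinner_self[symmetric])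
  also have "\<dots> = a * cnj a * cinner x x"
    by (simp add: cinner_scaleC_left cinner_scaleC_right)
  also have "\<dots> = complex_of_real ((cmod a * norm x)\<^sup>2)"
    by (simp only: cinner_self power_mult_distrib of_real_mult complex_norm_square)
  finally have "(norm (a *\<^sub>C x))\<^sup>2 = (cmod a * norm x)\<^sup>2"
    by (simp only: of_real_eq_iff)
  then show ?thesis by simp
qed

text \<open>Rotating x by the phase \<open>u\<close> makes the inner product real and nonnegative,
  which reduces the claim to the real Cauchy-Schwarz inequality. If the inner product vanishes,
  \<open>u\<close> is 0, so its modulus is only known to be at most 1.\<close>

lemma norm_cinner_le: "cmod (cinner x y) \<le> norm x * norm (y::'a::complex_inner)"
proof -
  define u where "u = cnj (sgn (cinner x y))"
  have "u * cinner x y = complex_of_real (cmod (cinner x y))"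
    by (cases "cinner x y = 0")
      (simp_all add: u_def sgn_eq field_simps power2_eq_square flip: complex_norm_square)
  then have "cmod (cinner x y) = Re (cinner (u *\<^sub>C x) y)"
    by (simp add: cinner_scaleC_left)
  also have "\<dots> \<le> norm (u *\<^sub>C x) * norm y"
    by (metis inner_eq_Re_cinner norm_cauchy_schwarz)
  also have "\<dots> \<le> norm x * norm y"
    by (intro mult_right_mono) (auto simp: u_def norm_sgn)
  finally show ?thesis .
qed

lemma bounded_linear_cinner_left: "bounded_linear (\<lambda>x. cinner x (y::'a::complex_inner))"
proof (rule bounded_linear_intro[where K = "norm y"])
  show "cinner (r *\<^sub>R x) y = r *\<^sub>R cinner x y" for r x
    using cinner_scaleC_left[of "complex_of_real r" x y]
    by (simp add: scaleC_of_real scaleR_conv_of_real)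
qed (simp_all add: cinner_add_left norm_cinner_le)

lemma bounded_linear_scaleC_right: "bounded_linear (\<lambda>x::'a::complex_inner. a *\<^sub>C x)"
  by (rule bounded_linear_intro[where K = "cmod a"])
    (simp_all add: scaleC_add_right scaleC_scaleC mult.commute flip: scaleC_of_real)

text \<open>As \<open>cadjoint\<close> is a definite description, a candidate must also be shown
  unique; \<open>cinner_eqI\<close> does this.\<close>

lemma cadjoint_eqI:
  assumes "\<And>x y. cinner (T x) y = cinner x (T' y)"
  shows "cadjoint T = T'"
  unfolding cadjoint_def
proof (rule the_equality)
  fix T'' assume T'': "\<forall>x y. cinner (T x) y = cinner x (T'' y)"
  show "T'' = T'"
    by (rule ext, rule cinner_eqI) (metis T'' assms)
qed (use assms in blast)

text \<open>This replaces the adjoint of the inverse multiplier in statement (1) by the inverse of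
  an explicit series operator.\<close>

lemma cadjoint_inv:
  fixes T T' :: "'a::complex_inner \<Rightarrow> 'a"
  assumes adj: "\<And>x y. cinner (T x) y = cinner x (T' y)" and "bij T" "bij T'"
  shows "cadjoint (inv T) = inv T'"
proof (rule cadjoint_eqI)
  fix x y
  show "cinner (inv T x) y = cinner x (inv T' y)"
    using adj[of "inv T x" "inv T' y"] assms(2,3) by (simp add: bij_is_surj surj_f_inv_f)
qed

lemma bounded_clinear_compose:
  "bounded_clinear S \<Longrightarrow> bounded_clinear T \<Longrightarrow> bounded_clinear (\<lambda>x. S (T x))"
  by (auto simp: bounded_clinear_def intro: bounded_linear_compose)


section \<open>Frames\<close>

text \<open>Analysis with \<theta> followed by synthesis with \<phi>. Frame operators are the case
  \<theta> = \<phi>, and multipliers arise by absorbing the weights into \<theta>.\<close>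

definition cross_operator ::
    "'i set \<Rightarrow> ('i \<Rightarrow> 'a::complex_hilbert) \<Rightarrow> ('i \<Rightarrow> 'a) \<Rightarrow> 'a \<Rightarrow> 'a" where
  "cross_operator I \<phi> \<theta> f = (\<Sum>\<^sub>\<infinity>n\<in>I. cinner f (\<theta> n) *\<^sub>C \<phi> n)"

lemma frame_operator_eq_cross: "frame_operator I \<phi> = cross_operator I \<phi> \<phi>"
  by (simp add: fun_eq_iff frame_operator_def cross_operator_def)

text \<open>Used to replace the weights m by their conjugates, which leaves the moduli of all
  coefficients unchanged.\<close>

lemma is_frame_cong:
  assumes "\<And>f n. n \<in> I \<Longrightarrow> cmod (cinner f (\<phi> n)) = cmod (cinner f (\<psi> n))"
  shows "is_frame I \<phi> \<longleftrightarrow> is_frame I \<psi>"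
  using assms by (simp add: is_frame_def cong: summable_on_cong infsum_cong)

section \<open>Synthesis from square-summable coefficients\<close>

lemma summable_on_if_norm2_le:
  fixes f :: "'i \<Rightarrow> 'a::{real_normed_vector, complete_space}"
  assumes g: "g summable_on I"
    and le: "\<And>F. finite F \<Longrightarrow> F \<subseteq> I \<Longrightarrow> (norm (sum f F))\<^sup>2 \<le> B * sum g F"
    and B: "B \<ge> 0"
  shows "f summable_on I"
proof -
  \<comment> \<open>By completeness a Cauchy condition along the finite subsets suffices: sums of f
    outside a large F0 are controlled by the small tails of g.\<close>
  have "\<exists>P. eventually P (finite_subsets_at_top I) \<and>
      (\<forall>F G. P F \<and> P G \<longrightarrow> dist (sum f F) (sum f G) < e)" if e: "e > 0" for e
  proof -
    \<comment> \<open>Chosen so that (B + 1) * 2 d = (e/2)^2; using B + 1 avoids division by zero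
      and keeps the estimate strict when B = 0.\<close>
    define d where "d = (e / 2)\<^sup>2 / (2 * (B + 1))"
    have d: "d > 0" using e B by (simp add: d_def)
    have "eventually (\<lambda>F. dist (sum g F) (infsum g I) < d) (finite_subsets_at_top I)"
      using infsum_tendsto[OF g] d by (simp add: tendsto_iff)
    then obtain F0 where F0: "finite F0" "F0 \<subseteq> I"
      and near: "\<And>F. finite F \<Longrightarrow> F0 \<subseteq> F \<Longrightarrow> F \<subseteq> I \<Longrightarrow> dist (sum g F) (infsum g I) < d"
      unfolding eventually_finite_subsets_at_top by metis
    have close: "dist (sum f F) (sum f F0) < e / 2"
      if F: "finite F" "F0 \<subseteq> F" "F \<subseteq> I" for F
    proof -
      have "sum g (F - F0) = sum g F - sum g F0"
        using F by (simp add: sum_diff)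
      also have "\<dots> < 2 * d"
        using near[OF F] near[OF F0(1) order_refl F0(2)] by (simp add: dist_real_def)
      finally have small: "sum g (F - F0) < 2 * d" .
      have "(norm (sum f F - sum f F0))\<^sup>2 = (norm (sum f (F - F0)))\<^sup>2"
        using F by (simp add: sum_diff)
      also have "\<dots> \<le> B * sum g (F - F0)"
        using F by (intro le) auto
      also have "\<dots> \<le> B * (2 * d)"
        using small B by (intro mult_left_mono) auto
      also have "\<dots> < (B + 1) * (2 * d)"
        using d by simp
      also have "\<dots> = (e / 2)\<^sup>2"
        using B by (simp add: d_def field_simps)
      finally have "norm (sum f F - sum f F0) < e / 2"
        by (rule power_less_imp_less_base) (use e in simp)
      then show ?thesis by (simp add: dist_norm)
    qed
    show ?thesis
    proof (intro exI conjI allI impI)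
      show "eventually (\<lambda>F. finite F \<and> F0 \<subseteq> F \<and> F \<subseteq> I) (finite_subsets_at_top I)"
        unfolding eventually_finite_subsets_at_top using F0 by blast
      show "dist (sum f F) (sum f G) < e"
        if "(finite F \<and> F0 \<subseteq> F \<and> F \<subseteq> I) \<and> finite G \<and> F0 \<subseteq> G \<and> G \<subseteq> I" for F G
        by (rule dist_triangle_half_l[of _ "sum f F0"]) (use that close in auto)
    qed
  qed
  then have "cauchy_filter (filtermap (sum f) (finite_subsets_at_top I))"
    by (simp add: cauchy_filter_metric_filtermap)
  then obtain L where "(sum f \<longlongrightarrow> L) (finite_subsets_at_top I)"
    using complete_uniform[where S = "UNIV::'a set"] complete_UNIV
    by (force simp add: filterlim_def)
  then show ?thesis
    using summable_on_def has_sum_def by blast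
qed

text \<open>With v the synthesised vector, expanding \<open>cinner v v\<close> and applying
  Cauchy-Schwarz and then the Bessel bound at v itself bounds the fourth power of the norm of v by B
  s times its square; one square cancels.\<close>

lemma bessel_synthesis_finite:
  fixes \<phi> :: "'i \<Rightarrow> 'a::complex_inner"
  assumes bessel: "\<And>f. (\<Sum>n\<in>F. (cmod (cinner f (\<phi> n)))\<^sup>2) \<le> B * (norm f)\<^sup>2"
    and B: "B \<ge> 0"
  shows "(norm (\<Sum>n\<in>F. c n *\<^sub>C \<phi> n))\<^sup>2 \<le> B * (\<Sum>n\<in>F. (cmod (c n))\<^sup>2)"
proof -
  define v where "v = (\<Sum>n\<in>F. c n *\<^sub>C \<phi> n)"
  define s where "s = (\<Sum>n\<in>F. (cmod (c n))\<^sup>2)"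
  interpret bounded_linear "\<lambda>x. cinner x v"
    by (rule bounded_linear_cinner_left)
  have "(norm v)\<^sup>2 = cmod (cinner v v)"
    by (simp add: cinner_self norm_power)
  also have "cinner v v = (\<Sum>n\<in>F. c n * cinner (\<phi> n) v)"
    by (subst v_def) (simp add: sum cinner_scaleC_left)
  also have "cmod \<dots> \<le> (\<Sum>n\<in>F. cmod (c n) * cmod (cinner v (\<phi> n)))"
    by (rule sum_norm_le) (simp add: norm_mult cinner_commute[of v])
  finally have "((norm v)\<^sup>2)\<^sup>2 \<le> (\<Sum>n\<in>F. cmod (c n) * cmod (cinner v (\<phi> n)))\<^sup>2"
    by (intro power_mono) auto
  also have "\<dots> \<le> s * (\<Sum>n\<in>F. (cmod (cinner v (\<phi> n)))\<^sup>2)"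
    unfolding s_def by (rule Cauchy_Schwarz_ineq_sum)
  also have "\<dots> \<le> s * (B * (norm v)\<^sup>2)"
    by (intro mult_left_mono bessel) (auto simp: s_def sum_nonneg)
  finally have le: "(norm v)\<^sup>2 * (norm v)\<^sup>2 \<le> (B * s) * (norm v)\<^sup>2"
    by (simp add: power2_eq_square mult_ac)
  show ?thesis
  proof (cases "v = 0")
    case True
    then show ?thesis using B by (simp add: v_def[symmetric] sum_nonneg)
  next
    case False
    have "(norm v)\<^sup>2 \<le> B * s"
      by (rule mult_right_le_imp_le[OF le]) (use False in simp)
    then show ?thesis by (simp add: v_def s_def)
  qed
qed

lemma is_frameE:
  assumes "is_frame I \<phi>"
  obtains A B where "A > 0" "B > 0"
    "\<And>f. (\<lambda>n. (cmod (cinner f (\<phi> n)))\<^sup>2) summable_on I"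
    "\<And>f. A * (norm f)\<^sup>2 \<le> (\<Sum>\<^sub>\<infinity>n\<in>I. (cmod (cinner f (\<phi> n)))\<^sup>2)"
    "\<And>f. (\<Sum>\<^sub>\<infinity>n\<in>I. (cmod (cinner f (\<phi> n)))\<^sup>2) \<le> B * (norm f)\<^sup>2"
  using assms unfolding is_frame_def by metis

text \<open>Partial sums inherit the upper frame bound, so the finite estimate holds uniformly on
  finite subsets of I. It yields convergence and survives the limit.\<close>

lemma frame_synthesis:
  fixes \<phi> :: "'i \<Rightarrow> 'a::complex_hilbert"
  assumes "is_frame I \<phi>"
  obtains B where "B > 0"
    "\<And>c. (\<lambda>n. (cmod (c n))\<^sup>2) summable_on I \<Longrightarrow> (\<lambda>n. c n *\<^sub>C \<phi> n) summable_on I"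
    "\<And>c. (\<lambda>n. (cmod (c n))\<^sup>2) summable_on I \<Longrightarrow>
       (norm (\<Sum>\<^sub>\<infinity>n\<in>I. c n *\<^sub>C \<phi> n))\<^sup>2 \<le> B * (\<Sum>\<^sub>\<infinity>n\<in>I. (cmod (c n))\<^sup>2)"
proof -
  obtain A B where B: "B > 0"
    and sm: "\<And>f. (\<lambda>n. (cmod (cinner f (\<phi> n)))\<^sup>2) summable_on I"
    and le: "\<And>f. (\<Sum>\<^sub>\<infinity>n\<in>I. (cmod (cinner f (\<phi> n)))\<^sup>2) \<le> B * (norm f)\<^sup>2"
    using is_frameE[OF assms] by metis
  have fin: "(norm (\<Sum>n\<in>F. c n *\<^sub>C \<phi> n))\<^sup>2 \<le> B * (\<Sum>n\<in>F. (cmod (c n))\<^sup>2)"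
    if "finite F" "F \<subseteq> I" for c F
  proof (rule bessel_synthesis_finite)
    show "(\<Sum>n\<in>F. (cmod (cinner f (\<phi> n)))\<^sup>2) \<le> B * (norm f)\<^sup>2" for f
      by (rule order_trans[OF finite_sum_le_infsum le]) (use sm that in auto)
  qed (use B in simp)
  show thesis
  proof
    fix c :: "'i \<Rightarrow> complex"
    assume c: "(\<lambda>n. (cmod (c n))\<^sup>2) summable_on I"
    show s: "(\<lambda>n. c n *\<^sub>C \<phi> n) summable_on I"
      by (rule summable_on_if_norm2_le[OF c fin]) (use B in auto)
    have "((\<lambda>F. (norm (\<Sum>n\<in>F. c n *\<^sub>C \<phi> n))\<^sup>2)
        \<longlongrightarrow> (norm (\<Sum>\<^sub>\<infinity>n\<in>I. c n *\<^sub>C \<phi> n))\<^sup>2) (finite_subsets_at_top I)"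
      by (intro tendsto_intros infsum_tendsto s)
    then show "(norm (\<Sum>\<^sub>\<infinity>n\<in>I. c n *\<^sub>C \<phi> n))\<^sup>2 \<le> B * (\<Sum>\<^sub>\<infinity>n\<in>I. (cmod (c n))\<^sup>2)"
    proof (rule tendsto_upperbound)
      show "\<forall>\<^sub>F F in finite_subsets_at_top I.
          (norm (\<Sum>n\<in>F. c n *\<^sub>C \<phi> n))\<^sup>2 \<le> B * (\<Sum>\<^sub>\<infinity>n\<in>I. (cmod (c n))\<^sup>2)"
      proof (rule eventually_finite_subsets_at_top_weakI)
        fix F assume F: "finite F" "F \<subseteq> I"
        have "B * (\<Sum>n\<in>F. (cmod (c n))\<^sup>2) \<le> B * (\<Sum>\<^sub>\<infinity>n\<in>I. (cmod (c n))\<^sup>2)"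
          using B by (intro mult_left_mono finite_sum_le_infsum c F) auto
        then show "(norm (\<Sum>n\<in>F. c n *\<^sub>C \<phi> n))\<^sup>2 \<le> B * (\<Sum>\<^sub>\<infinity>n\<in>I. (cmod (c n))\<^sup>2)"
          using fin[OF F, of c] by linarith
      qed
    qed simp
  qed (use B in simp)
qed

section \<open>Cross operators and frame operators\<close>

lemma cross_operator_summable:
  assumes "is_frame I \<phi>" "is_frame I \<theta>"
  shows "(\<lambda>n. cinner f (\<theta> n) *\<^sub>C \<phi> n) summable_on I"
proof -
  have "(\<lambda>n. (cmod (cinner f (\<theta> n)))\<^sup>2) summable_on I"
    using is_frameE[OF assms(2)] by metis
  then show ?thesis
    using frame_synthesis[OF assms(1)] by metis
qed

lemma cross_operator_has_sum:
  assumes "is_frame I \<phi>" "is_frame I \<theta>"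
  shows "((\<lambda>n. cinner f (\<theta> n) *\<^sub>C \<phi> n) has_sum cross_operator I \<phi> \<theta> f) I"
  using cross_operator_summable[OF assms] by (simp add: cross_operator_def)

lemma cross_operator_bounded_clinear:
  assumes \<phi>: "is_frame I \<phi>" and \<theta>: "is_frame I \<theta>"
  shows "bounded_clinear (cross_operator I \<phi> \<theta>)"
proof -
  note hs = cross_operator_has_sum[OF \<phi> \<theta>]
  have add: "cross_operator I \<phi> \<theta> (f + g) = cross_operator I \<phi> \<theta> f + cross_operator I \<phi> \<theta> g" for f g
    by (rule has_sum_unique[OF hs])
      (use has_sum_add[OF hs[of f] hs[of g]] in \<open>simp add: cinner_add_left scaleC_add_left\<close>)
  have scaleC: "cross_operator I \<phi> \<theta> (a *\<^sub>C f) = a *\<^sub>C cross_operator I \<phi> \<theta> f" for a f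
    by (rule has_sum_unique[OF hs])
      (use has_sum_bounded_linear[OF bounded_linear_scaleC_right hs[of f], of a]
        in \<open>simp add: cinner_scaleC_left scaleC_scaleC\<close>)
  obtain B where B: "B > 0"
    "\<And>c. (\<lambda>n. (cmod (c n))\<^sup>2) summable_on I \<Longrightarrow>
       (norm (\<Sum>\<^sub>\<infinity>n\<in>I. c n *\<^sub>C \<phi> n))\<^sup>2 \<le> B * (\<Sum>\<^sub>\<infinity>n\<in>I. (cmod (c n))\<^sup>2)"
    by (rule frame_synthesis[OF \<phi>], rule that)
  obtain C where C: "C > 0"
    "\<And>f. (\<lambda>n. (cmod (cinner f (\<theta> n)))\<^sup>2) summable_on I"
    "\<And>f. (\<Sum>\<^sub>\<infinity>n\<in>I. (cmod (cinner f (\<theta> n)))\<^sup>2) \<le> C * (norm f)\<^sup>2"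
    using is_frameE[OF \<theta>] by metis
  \<comment> \<open>B bounds synthesis with \<phi> and C bounds analysis with \<theta>, both for
    squared norms.\<close>
  have bound: "norm (cross_operator I \<phi> \<theta> f) \<le> norm f * sqrt (B * C)" for f
  proof (rule power2_le_imp_le)
    have "(norm (cross_operator I \<phi> \<theta> f))\<^sup>2 \<le> B * (C * (norm f)\<^sup>2)"
      unfolding cross_operator_def
      by (rule order_trans[OF B(2)[OF C(2)] mult_left_mono[OF C(3)]]) (use B in simp)
    then show "(norm (cross_operator I \<phi> \<theta> f))\<^sup>2 \<le> (norm f * sqrt (B * C))\<^sup>2"
      using B C by (simp add: power_mult_distrib mult_ac)
  qed (use B C in simp)
  show ?thesis
    unfolding bounded_clinear_def
    by (intro conjI allI bounded_linear_intro[OF add _ bound] scaleC)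
      (simp add: scaleC flip: scaleC_of_real)
qed

text \<open>Both sides are sums of the same scalar series.\<close>

lemma cross_operator_adjoint:
  assumes \<phi>: "is_frame I \<phi>" and \<theta>: "is_frame I \<theta>"
  shows "cinner (cross_operator I \<phi> \<theta> f) g = cinner f (cross_operator I \<theta> \<phi> g)"
proof (rule has_sum_unique)
  show "((\<lambda>n. cinner f (\<theta> n) * cinner (\<phi> n) g) has_sum cinner (cross_operator I \<phi> \<theta> f) g) I"
    using has_sum_bounded_linear[OF bounded_linear_cinner_left cross_operator_has_sum[OF \<phi> \<theta>], of f g]
    by (simp add: cinner_scaleC_left)
  \<comment> \<open>The inner product is linear only in its first argument, so the right-hand side
    is expanded with its arguments exchanged and then conjugated.\<close>
  have "((\<lambda>n. cinner g (\<phi> n) * cinner (\<theta> n) f) has_sum cinner (cross_operator I \<theta> \<phi> g) f) I"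
    using has_sum_bounded_linear[OF bounded_linear_cinner_left cross_operator_has_sum[OF \<theta> \<phi>], of g f]
    by (simp add: cinner_scaleC_left)
  then have "((\<lambda>n. cnj (cinner g (\<phi> n) * cinner (\<theta> n) f))
      has_sum cnj (cinner (cross_operator I \<theta> \<phi> g) f)) I"
    by (simp only: has_sum_cnj_iff)
  then show "((\<lambda>n. cinner f (\<theta> n) * cinner (\<phi> n) g) has_sum cinner f (cross_operator I \<theta> \<phi> g)) I"
    by (simp add: cinner_commute[symmetric] mult.commute)
qed

text \<open>Taking real parts, the swapped operator is also the adjoint for the real inner product,
  where \<open>bij_adjoint\<close> applies.\<close>

lemma bij_cross_operator_swap:
  assumes "is_frame I \<phi>" "is_frame I \<theta>" "bij (cross_operator I \<phi> \<theta>)"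
  shows "bij (cross_operator I \<theta> \<phi>)"
  by (rule bij_adjoint[where T = "cross_operator I \<phi> \<theta>"])
    (use assms cross_operator_bounded_clinear[of I] in
      \<open>auto simp: bounded_clinear_def inner_eq_Re_cinner cross_operator_adjoint\<close>)

text \<open>The quadratic form of the frame operator is the frame sum, so the lower frame bound is a
  coercivity constant.\<close>

lemma frame_operator_coercive:
  fixes \<phi> :: "'i \<Rightarrow> 'a::complex_hilbert"
  assumes \<phi>: "is_frame I \<phi>"
  obtains A where "A > 0" "\<And>f. A * (norm f)\<^sup>2 \<le> inner (frame_operator I \<phi> f) f"
proof -
  obtain A where A: "A > 0"
    "\<And>f. (\<lambda>n. (cmod (cinner f (\<phi> n)))\<^sup>2) summable_on I"
    "\<And>f. A * (norm f)\<^sup>2 \<le> (\<Sum>\<^sub>\<infinity>n\<in>I. (cmod (cinner f (\<phi> n)))\<^sup>2)"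
    using is_frameE[OF \<phi>] by metis
  have "inner (frame_operator I \<phi> f) f = (\<Sum>\<^sub>\<infinity>n\<in>I. (cmod (cinner f (\<phi> n)))\<^sup>2)" for f
  proof -
    have term_eq: "cinner (cinner f (\<phi> n) *\<^sub>C \<phi> n) f = complex_of_real ((cmod (cinner f (\<phi> n)))\<^sup>2)" for n
      unfolding cinner_scaleC_left cinner_commute[of "\<phi> n" f] complex_norm_square ..
    have "((\<lambda>n. Re (cinner (cinner f (\<phi> n) *\<^sub>C \<phi> n) f))
        has_sum Re (cinner (frame_operator I \<phi> f) f)) I"
      unfolding frame_operator_eq_cross
      by (intro has_sum_Re has_sum_bounded_linear[OF bounded_linear_cinner_left]
          cross_operator_has_sum \<phi>)
    then show ?thesis
      unfolding term_eq Re_complex_of_real inner_eq_Re_cinner by (simp add: infsumI)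
  qed
  with A show thesis
    using that by metis
qed

lemma
  assumes \<phi>: "is_frame I \<phi>"
  shows frame_operator_bij: "bij (frame_operator I \<phi>)"
    and frame_operator_inv_bounded_clinear: "bounded_clinear (inv (frame_operator I \<phi>))"
proof -
  obtain A where A: "A > 0" "\<And>f. A * (norm f)\<^sup>2 \<le> inner (frame_operator I \<phi> f) f"
    using frame_operator_coercive[OF \<phi>] by blast
  have cl: "bounded_clinear (frame_operator I \<phi>)"
    unfolding frame_operator_eq_cross by (rule cross_operator_bounded_clinear[OF \<phi> \<phi>])
  then have lin: "bounded_linear (frame_operator I \<phi>)"
    by (simp add: bounded_clinear_def)
  show bij: "bij (frame_operator I \<phi>)"
    by (rule lax_milgram[OF lin A])
  have "inv (frame_operator I \<phi>) (c *\<^sub>C x) = c *\<^sub>C inv (frame_operator I \<phi>) x" for c x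
    using bij cl by (intro inv_f_eq) (auto simp: bounded_clinear_def bij_is_inj bij_is_surj surj_f_inv_f)
  then show "bounded_clinear (inv (frame_operator I \<phi>))"
    unfolding bounded_clinear_def
    using bounded_linear_inv[OF lin bij A(1) coercive_bounded_below[OF A(2)]] by blast
qed

section \<open>Multipliers as cross operators\<close>

lemma multiplier_eq_cross:
  "multiplier I m \<phi> \<psi> = cross_operator I \<phi> (\<lambda>n. cnj (m n) *\<^sub>C \<psi> n)"
  by (simp add: fun_eq_iff multiplier_def cross_operator_def cinner_scaleC_right)

text \<open>For frames the series converges everywhere and defines a bounded operator, so only
  bijectivity is left to decide.\<close>

lemma multiplier_invertible_iff_bij:
  assumes "is_frame I \<phi>" "is_frame I (\<lambda>n. cnj (m n) *\<^sub>C \<psi> n)"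
  shows "multiplier_invertible I m \<phi> \<psi> \<longleftrightarrow> bij (cross_operator I \<phi> (\<lambda>n. cnj (m n) *\<^sub>C \<psi> n))"
  using cross_operator_summable[OF assms] cross_operator_bounded_clinear[OF assms]
  by (auto simp: multiplier_invertible_def multiplier_dom_def bounded_bijective_def
      multiplier_eq_cross cinner_scaleC_right)

theorem proposition3p19:
  fixes I :: "'i set"
    and \<phi> \<psi> :: "'i \<Rightarrow> 'a::complex_hilbert"
    and m :: "'i \<Rightarrow> complex"
  assumes "separable_space (euclidean :: 'a topology)"
    and "countable I"
    and "is_frame I \<phi>"
    and "is_frame I \<psi>"
    and "\<forall>n\<in>I. m n \<noteq> 0"
    and "is_frame I (\<lambda>n. m n *\<^sub>C \<psi> n)"
  defines "S1 \<equiv> multiplier_invertible I m \<phi> \<psi> \<and>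
      (\<forall>n\<in>I. cadjoint (inv (multiplier I m \<phi> \<psi>)) (cnj (m n) *\<^sub>C \<psi> n) = canonical_dual I \<phi> n)"
    and "S2 \<equiv> equivalent_frames I \<phi> (\<lambda>n. cnj (m n) *\<^sub>C \<psi> n)"
    and "S3 \<equiv> multiplier_invertible I m \<phi> \<psi> \<and>
      multiplier_dom I (\<lambda>n. 1 / m n) (canonical_dual I \<psi>) (canonical_dual I \<phi>) = UNIV \<and>
      inv (multiplier I m \<phi> \<psi>) =
        multiplier I (\<lambda>n. 1 / m n) (canonical_dual I \<psi>) (canonical_dual I \<phi>)"
  shows "(S1 \<longleftrightarrow> S2) \<and> (S2 \<longrightarrow> S3)"
proof -
  note \<phi> = assms(3) and \<psi> = assms(4)
  define \<theta> where "\<theta> = (\<lambda>n. cnj (m n) *\<^sub>C \<psi> n)"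
  define M where "M = cross_operator I \<phi> \<theta>"
  define M' where "M' = cross_operator I \<theta> \<phi>"
  define S where "S = frame_operator I \<phi>"
  have \<theta>: "is_frame I \<theta>"
    unfolding \<theta>_def using assms(6)
    by (rule is_frame_cong[THEN iffD1, rotated]) (simp add: cinner_scaleC_right norm_mult)
  have M: "multiplier I m \<phi> \<psi> = M"
    by (simp add: M_def \<theta>_def multiplier_eq_cross)
  have invertible_iff: "multiplier_invertible I m \<phi> \<psi> \<longleftrightarrow> bij M"
    unfolding M_def \<theta>_def
    by (rule multiplier_invertible_iff_bij) (use \<phi> \<theta> in \<open>auto simp: \<theta>_def\<close>)
  have adj: "cinner (M x) y = cinner x (M' y)" for x y
    unfolding M_def M'_def by (rule cross_operator_adjoint[OF \<phi> \<theta>])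
  have bij_M': "bij M'" if "bij M"
    using bij_cross_operator_swap[OF \<phi> \<theta>] that by (simp add: M_def M'_def)
  have S: "bij S" "bounded_clinear (inv S)"
    unfolding S_def by (rule frame_operator_bij[OF \<phi>] frame_operator_inv_bounded_clinear[OF \<phi>])+
  have S_inv [simp]: "S (inv S x) = x" for x
    using S(1) by (simp add: bij_is_surj surj_f_inv_f)
  have S1_iff: "S1 \<longleftrightarrow> bij M \<and> (\<forall>n\<in>I. inv M' (\<theta> n) = inv S (\<phi> n))"
    using cadjoint_inv[OF adj _ bij_M'] unfolding S1_def invertible_iff M canonical_dual_def
    by (auto simp: \<theta>_def S_def)
  have S1_S2: S2 if S1
  proof -
    have bij: "bij M" and dual: "\<And>n. n \<in> I \<Longrightarrow> inv M' (\<theta> n) = inv S (\<phi> n)"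
      using that S1_iff by auto
    define G where "G x = M' (inv S x)" for x
    have "bij (M' \<circ> inv S)"
      by (intro bij_comp bij_imp_bij_inv S bij_M' bij)
    then have "bij G"
      by (simp add: G_def[abs_def] comp_def)
    moreover have "bounded_clinear G"
      unfolding G_def M'_def
      by (rule bounded_clinear_compose[OF cross_operator_bounded_clinear[OF \<theta> \<phi>] S(2)])
    moreover have "\<theta> n = G (\<phi> n)" if "n \<in> I" for n
      \<comment> \<open>Turning \<open>inv S (\<phi> n)\<close> back into
        \<open>inv M' (\<theta> n)\<close> lets M' cancel its inverse.\<close>
      using dual[OF that] bij_M'[OF bij]
      by (simp add: G_def flip: dual[OF that]) (simp add: bij_is_surj surj_f_inv_f)
    ultimately show ?thesis
      using \<phi> \<theta> by (auto simp: S2_def equivalent_frames_def bounded_bijective_def \<theta>_def)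
  qed
  have S2_S1: S1 if equiv: S2
  proof -
    obtain G where G: "bounded_clinear G" "bij G" "\<And>n. n \<in> I \<Longrightarrow> \<theta> n = G (\<phi> n)"
      using equiv by (auto simp: S2_def equivalent_frames_def bounded_bijective_def \<theta>_def)
    \<comment> \<open>The choice \<eta> = \<theta> gives G M =
      \<open>frame_operator I \<theta>\<close>, and \<eta> = \<phi> gives G S = M'.\<close>
    have push: "G (cross_operator I \<phi> \<eta> f) = cross_operator I \<theta> \<eta> f" if \<eta>: "is_frame I \<eta>" for \<eta> f
    proof (rule has_sum_unique)
      show "((\<lambda>n. G (cinner f (\<eta> n) *\<^sub>C \<phi> n)) has_sum G (cross_operator I \<phi> \<eta> f)) I"
        by (rule has_sum_bounded_linear[OF _ cross_operator_has_sum[OF \<phi> \<eta>]])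
          (use G(1) in \<open>simp add: bounded_clinear_def\<close>)
      have "((\<lambda>n. cinner f (\<eta> n) *\<^sub>C \<theta> n) has_sum cross_operator I \<theta> \<eta> f) I"
        by (rule cross_operator_has_sum[OF \<theta> \<eta>])
      then show "((\<lambda>n. G (cinner f (\<eta> n) *\<^sub>C \<phi> n)) has_sum cross_operator I \<theta> \<eta> f) I"
        by (rule has_sum_cong[THEN iffD1, rotated])
          (use G in \<open>auto simp: bounded_clinear_def\<close>)
    qed
    have M_eq: "M = inv G \<circ> frame_operator I \<theta>"
      using push[OF \<theta>] G(2)
      by (auto simp: fun_eq_iff M_def frame_operator_eq_cross bij_is_inj simp flip: push[OF \<theta>])
    have bij: "bij M"
      unfolding M_eq by (intro bij_comp bij_imp_bij_inv G frame_operator_bij \<theta>)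
    have M'_S: "M' x = G (S x)" for x
      using push[OF \<phi>] by (simp add: M'_def S_def frame_operator_eq_cross)
    \<comment> \<open>M' maps \<open>inv S (\<phi> n)\<close> to G (\<phi> n), which is \<theta> n,
      and M' is injective.\<close>
    have "inv M' (\<theta> n) = inv S (\<phi> n)" if "n \<in> I" for n
      by (rule inv_f_eq) (use bij_M'[OF bij] G(3)[OF that] in \<open>simp_all add: M'_S bij_is_inj\<close>)
    with bij show ?thesis
      using S1_iff by blast
  qed
  have S1_S3: S3 if S1
  proof -
    have bij: "bij M" and dual: "\<And>n. n \<in> I \<Longrightarrow> inv M' (\<theta> n) = inv S (\<phi> n)"
      using that S1_iff by auto
    \<comment> \<open>Moving M' across the inner product cancels \<open>inv M'\<close>; the weight
      that \<theta> n contributes is then divided out, as m n is nonzero on I.\<close>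
    have coeff: "1 / m n * cinner f (canonical_dual I \<phi> n) = cinner (inv M f) (\<psi> n)"
      if n: "n \<in> I" for f n
    proof -
      have "cinner f (canonical_dual I \<phi> n) = cinner (M (inv M f)) (inv M' (\<theta> n))"
        using bij by (simp add: canonical_dual_def S_def[symmetric] dual[OF n] bij_is_surj surj_f_inv_f)
      also have "\<dots> = cinner (inv M f) (\<theta> n)"
        using bij_M'[OF bij] by (simp add: adj bij_is_surj surj_f_inv_f)
      also have "\<dots> = m n * cinner (inv M f) (\<psi> n)"
        by (simp add: \<theta>_def cinner_scaleC_right)
      finally show ?thesis
        using assms(5) n by simp
    qed
    \<comment> \<open>Proved as \<open>has_sum\<close> so that it yields both the full domain and
      the value in (3); an equation for the infinite sum alone could reflect its default 0.\<close>
    have hs: "((\<lambda>n. (1 / m n * cinner f (canonical_dual I \<phi> n)) *\<^sub>C canonical_dual I \<psi> n)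
        has_sum inv M f) I" for f
    proof -
      define R where "R = inv (frame_operator I \<psi>)"
      have R: "bounded_clinear R"
        unfolding R_def by (rule frame_operator_inv_bounded_clinear[OF \<psi>])
      have "((\<lambda>n. R (cinner (inv M f) (\<psi> n) *\<^sub>C \<psi> n)) has_sum R (frame_operator I \<psi> (inv M f))) I"
        unfolding frame_operator_eq_cross
        by (rule has_sum_bounded_linear[OF _ cross_operator_has_sum[OF \<psi> \<psi>]])
          (use R in \<open>simp add: bounded_clinear_def\<close>)
      moreover have "R (frame_operator I \<psi> (inv M f)) = inv M f"
        unfolding R_def using frame_operator_bij[OF \<psi>] by (simp add: bij_is_inj)
      ultimately have "((\<lambda>n. R (cinner (inv M f) (\<psi> n) *\<^sub>C \<psi> n)) has_sum inv M f) I"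
        by simp
      then show ?thesis
        using R coeff
        by (simp add: bounded_clinear_def canonical_dual_def[of I \<psi>] R_def[symmetric] cong: has_sum_cong)
    qed
    then show ?thesis
      using bij
      by (auto simp: S3_def invertible_iff M multiplier_dom_def multiplier_def fun_eq_iff
          intro: has_sum_imp_summable infsumI[symmetric])
  qed
  \<comment> \<open>The implication from (2) to (3) passes through (1).\<close>
  show ?thesis
    using S1_S2 S2_S1 S1_S3 by blast
qed

end
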